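(* Let $m\ge 0$ be an integer and let $\gamma>-m$ be real. Let $R_\gamma\in(0,1)$ be the positive root of the equation $$\frac{y^m}{m+\gamma}-2\sum_{k=m+1}^{\infty}\frac{y^k}{k+\gamma}=0 .$$ Then for every $f(x)=\sum_{k=m}^{\infty}x^k a_k\in \mathcal{SRB}(\mathbb{B})$ (with $a_k\in\mathbb{O}$) and every $x\in\mathbb{B}$ with $|x|\le R_\gamma$, $$\sum_{k=m}^{\infty}\frac{1}{k+\gamma}|x^k a_k|\le \frac{1}{m+\gamma}|x|^m .$$ The radius $R_\gamma$ cannot be improved, i.e. for every $r\in(R_\gamma,1)$ there exists $f(x)=\sum_{k=m}^\infty x^k a_k\in\mathcal{SRB}(\mathbb{B})$ for which this inequality fails for $|x|=r$.
   Context: $\mathbb{O}$ is the real algebra of octonions, $\mathbb{O}=\mathbb{H}+l\mathbb{H}$ ($\mathbb{H}$ the quaternions) with $\overline{a+lb}=\overline a-lb$ and $(a+lb)(c+ld)=(ac-d\overline b)+l(\overline a d+cb)$, a non-commutative, non-associative, alternative division algebra. $|x|=\sqrt{x\overline x}$ is the Euclidean norm on $\mathbb{R}^8$; it is multiplicative. $\mathbb{B}=\{x\in\mathbb{O}:|x|<1\}$, $\mathbb{S}=\{I\in\mathbb{O}:I^2=-1\}$, and $\mathbb{D}$ is the open unit disk of $\mathbb{C}$. Slice regular functions on $\mathbb{B}$: a stem function on $\mathbb{D}$ is $F=F_1+iF_2:\mathbb{D}\to\mathbb{O}\otimes_{\mathbb{R}}\mathbb{C}$ with $\mathbb{O}$-valued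 components satisfying $F_1(\overline z)=F_1(z)$, $F_2(\overline z)=-F_2(z)$. It induces the slice function $f:\mathbb{B}\to\mathbb{O}$, $f(\alpha+I\beta)=F_1(\alpha+i\beta)+I F_2(\alpha+i\beta)$ for $I\in\mathbb{S}$ and real $\alpha,\beta$ with $\alpha+i\beta\in\mathbb{D}$. The function $f$ is slice regular if $F$ is $C^1$ and satisfies the Cauchy–Riemann equations $\partial_\alpha F_1=\partial_\beta F_2$, $\partial_\beta F_1=-\partial_\alpha F_2$ on $\mathbb{D}$. Every slice regular function on $\mathbb{B}$ has a convergent power series expansion $f(x)=\sum_{k=0}^\infty x^k a_k$ with $a_k\in\mathbb{O}$. $\mathcal{SRB}(\mathbb{B})$ is the class of slice regular functions $f$ on $\mathbb{B}$ with $|f(x)|\le 1$ for all $x\in\mathbb{B}$. Convention: $x^0=1$. *)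

theory Defs
  imports "HOL-Analysis.Analysis"
begin

section \<open>Quaternions\<close>

datatype quat = Quat (Re0: real) (Im1: real) (Im2: real) (Im3: real)

lemma quat_eq_iff:
  "x = y \<longleftrightarrow> Re0 x = Re0 y \<and> Im1 x = Im1 y \<and> Im2 x = Im2 y \<and> Im3 x = Im3 y"
  by (auto intro: quat.expand)

instantiation quat :: real_algebra_1
begin

definition "0 = Quat 0 0 0 0"
definition "1 = Quat 1 0 0 0"
definition "x + y = Quat (Re0 x + Re0 y) (Im1 x + Im1 y) (Im2 x + Im2 y) (Im3 x + Im3 y)"
definition "x - y = Quat (Re0 x - Re0 y) (Im1 x - Im1 y) (Im2 x - Im2 y) (Im3 x - Im3 y)"
definition "- x = Quat (- Re0 x) (- Im1 x) (- Im2 x) (- Im3 x)"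
definition "r *\<^sub>R x = Quat (r * Re0 x) (r * Im1 x) (r * Im2 x) (r * Im3 x)"
definition "x * y = Quat
  (Re0 x * Re0 y - Im1 x * Im1 y - Im2 x * Im2 y - Im3 x * Im3 y)
  (Re0 x * Im1 y + Im1 x * Re0 y + Im2 x * Im3 y - Im3 x * Im2 y)
  (Re0 x * Im2 y - Im1 x * Im3 y + Im2 x * Re0 y + Im3 x * Im1 y)
  (Re0 x * Im3 y + Im1 x * Im2 y - Im2 x * Im1 y + Im3 x * Re0 y)"

instance
  by standard
    (auto simp: quat_eq_iff zero_quat_def one_quat_def plus_quat_def minus_quat_def
      uminus_quat_def scaleR_quat_def times_quat_def algebra_simps)

end

lemma quat_sel [simp]:
  "Re0 0 = 0" "Im1 0 = 0" "Im2 0 = 0" "Im3 0 = 0"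
  "Re0 1 = 1" "Im1 1 = 0" "Im2 1 = 0" "Im3 1 = 0"
  "Re0 (x + y) = Re0 x + Re0 y" "Im1 (x + y) = Im1 x + Im1 y"
  "Im2 (x + y) = Im2 x + Im2 y" "Im3 (x + y) = Im3 x + Im3 y"
  "Re0 (x - y) = Re0 x - Re0 y" "Im1 (x - y) = Im1 x - Im1 y"
  "Im2 (x - y) = Im2 x - Im2 y" "Im3 (x - y) = Im3 x - Im3 y"
  "Re0 (- x) = - Re0 x" "Im1 (- x) = - Im1 x" "Im2 (- x) = - Im2 x" "Im3 (- x) = - Im3 x"
  "Re0 (r *\<^sub>R x) = r * Re0 x" "Im1 (r *\<^sub>R x) = r * Im1 x"
  "Im2 (r *\<^sub>R x) = r * Im2 x" "Im3 (r *\<^sub>R x) = r * Im3 x"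
  by (simp_all add: zero_quat_def one_quat_def plus_quat_def minus_quat_def
      uminus_quat_def scaleR_quat_def)

lemma quat_mult_sel [simp]:
  "Re0 (x * y) = Re0 x * Re0 y - Im1 x * Im1 y - Im2 x * Im2 y - Im3 x * Im3 y"
  "Im1 (x * y) = Re0 x * Im1 y + Im1 x * Re0 y + Im2 x * Im3 y - Im3 x * Im2 y"
  "Im2 (x * y) = Re0 x * Im2 y - Im1 x * Im3 y + Im2 x * Re0 y + Im3 x * Im1 y"
  "Im3 (x * y) = Re0 x * Im3 y + Im1 x * Im2 y - Im2 x * Im1 y + Im3 x * Re0 y"
  by (simp_all add: times_quat_def)

definition qcnj :: "quat \<Rightarrow> quat" where
  "qcnj x = Quat (Re0 x) (- Im1 x) (- Im2 x) (- Im3 x)"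

lemma qcnj_sel [simp]:
  "Re0 (qcnj x) = Re0 x" "Im1 (qcnj x) = - Im1 x" "Im2 (qcnj x) = - Im2 x" "Im3 (qcnj x) = - Im3 x"
  by (simp_all add: qcnj_def)

instantiation quat :: euclidean_space
begin

definition inner_quat :: "quat \<Rightarrow> quat \<Rightarrow> real" where
  "inner_quat x y = Re0 x * Re0 y + Im1 x * Im1 y + Im2 x * Im2 y + Im3 x * Im3 y"
definition "norm (x::quat) = sqrt (inner x x)"
definition "sgn (x::quat) = x /\<^sub>R norm x"
definition "dist (x::quat) y = norm (x - y)"
definition uniformity_quat :: "(quat \<times> quat) filter" where
  "uniformity_quat = (INF e\<in>{0<..}. principal {(x, y). dist x y < e})"
definition open_quat :: "quat set \<Rightarrow> bool" where
  "open_quat U \<longleftrightarrow> (\<forall>x\<in>U. eventually (\<lambda>(x', y). x' = x \<longrightarrow> y \<in> U) uniformity)"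
definition Basis_quat :: "quat set" where
  "Basis_quat = {Quat 1 0 0 0, Quat 0 1 0 0, Quat 0 0 1 0, Quat 0 0 0 1}"

instance
proof
  fix x y z :: quat and r :: real
  show "inner x y = inner y x" by (simp add: inner_quat_def algebra_simps)
  show "inner (x + y) z = inner x z + inner y z" by (simp add: inner_quat_def algebra_simps)
  show "inner (r *\<^sub>R x) y = r * inner x y" by (simp add: inner_quat_def algebra_simps)
  show "0 \<le> inner x x" by (simp add: inner_quat_def)
  show "(inner x x = 0) = (x = 0)"
    by (simp add: inner_quat_def quat_eq_iff add_nonneg_eq_0_iff)
  show "norm x = sqrt (inner x x)" by (rule norm_quat_def)
  show "sgn x = x /\<^sub>R norm x" by (rule sgn_quat_def)
  show "dist x y = norm (x - y)" by (rule dist_quat_def)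
  show "(Basis :: quat set) \<noteq> {}" by (simp add: Basis_quat_def)
  show "finite (Basis :: quat set)" by (simp add: Basis_quat_def)
  show "(\<forall>u\<in>Basis. inner x u = 0) = (x = 0)"
    unfolding Basis_quat_def inner_quat_def quat_eq_iff[of x] by simp
next
  fix u v :: quat
  assume "u \<in> Basis" "v \<in> Basis"
  then show "inner u v = (if u = v then 1 else 0)"
    unfolding Basis_quat_def inner_quat_def by (elim insertE emptyE) simp_all
qed (rule uniformity_quat_def open_quat_def)+

end

section \<open>Octonions\<close>

text \<open>\<^term>\<open>Oct a b\<close> stands for \<open>a + l b\<close>.\<close>

datatype oct = Oct (ofst: quat) (osnd: quat)

lemma oct_eq_iff: "x = y \<longleftrightarrow> ofst x = ofst y \<and> osnd x = osnd y"
  by (auto intro: oct.expand)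

instantiation oct :: real_vector
begin

definition "0 = Oct 0 0"
definition "x + y = Oct (ofst x + ofst y) (osnd x + osnd y)"
definition "x - y = Oct (ofst x - ofst y) (osnd x - osnd y)"
definition "- x = Oct (- ofst x) (- osnd x)"
definition "r *\<^sub>R x = Oct (r *\<^sub>R ofst x) (r *\<^sub>R osnd x)"

instance
  by standard
    (auto simp: oct_eq_iff zero_oct_def plus_oct_def minus_oct_def
      uminus_oct_def scaleR_oct_def algebra_simps)

end

lemma oct_sel [simp]:
  "ofst 0 = 0" "osnd 0 = 0"
  "ofst (x + y) = ofst x + ofst y" "osnd (x + y) = osnd x + osnd y"
  "ofst (x - y) = ofst x - ofst y" "osnd (x - y) = osnd x - osnd y"
  "ofst (- x) = - ofst x" "osnd (- x) = - osnd x"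
  "ofst (r *\<^sub>R x) = r *\<^sub>R ofst x" "osnd (r *\<^sub>R x) = r *\<^sub>R osnd x"
  by (simp_all add: zero_oct_def plus_oct_def minus_oct_def uminus_oct_def scaleR_oct_def)

text \<open>Multiplication is not associative, so the library power, which this instance makes
  available, reads \<open>x ^ Suc n = x * x ^ n\<close>.\<close>

instantiation oct :: power
begin

definition "1 = Oct 1 0"
definition "x * y = Oct
  (ofst x * ofst y - osnd y * qcnj (osnd x))
  (qcnj (ofst x) * osnd y + ofst y * osnd x)"

instance ..

end

lemma oct_mult_sel [simp]:
  "ofst 1 = 1" "osnd 1 = 0"
  "ofst (x * y) = ofst x * ofst y - osnd y * qcnj (osnd x)"
  "osnd (x * y) = qcnj (ofst x) * osnd y + ofst y * osnd x"
  by (simp_all add: one_oct_def times_oct_def)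

definition ocnj :: "oct \<Rightarrow> oct" where
  "ocnj x = Oct (qcnj (ofst x)) (- osnd x)"

instantiation oct :: euclidean_space
begin

definition inner_oct :: "oct \<Rightarrow> oct \<Rightarrow> real" where
  "inner_oct x y = inner (ofst x) (ofst y) + inner (osnd x) (osnd y)"
definition "norm (x::oct) = sqrt (inner x x)"
definition "sgn (x::oct) = x /\<^sub>R norm x"
definition "dist (x::oct) y = norm (x - y)"
definition uniformity_oct :: "(oct \<times> oct) filter" where
  "uniformity_oct = (INF e\<in>{0<..}. principal {(x, y). dist x y < e})"
definition open_oct :: "oct set \<Rightarrow> bool" where
  "open_oct U \<longleftrightarrow> (\<forall>x\<in>U. eventually (\<lambda>(x', y). x' = x \<longrightarrow> y \<in> U) uniformity)"
definition Basis_oct :: "oct set" where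
  "Basis_oct = (\<lambda>b. Oct b 0) ` Basis \<union> (\<lambda>b. Oct 0 b) ` Basis"

instance
proof
  fix x y z :: oct and r :: real
  show "inner x y = inner y x" by (simp add: inner_oct_def inner_commute)
  show "inner (x + y) z = inner x z + inner y z" by (simp add: inner_oct_def algebra_simps)
  show "inner (r *\<^sub>R x) y = r * inner x y" by (simp add: inner_oct_def algebra_simps)
  show "0 \<le> inner x x" by (simp add: inner_oct_def)
  show "(inner x x = 0) = (x = 0)"
    by (simp add: inner_oct_def oct_eq_iff add_nonneg_eq_0_iff)
  show "norm x = sqrt (inner x x)" by (rule norm_oct_def)
  show "sgn x = x /\<^sub>R norm x" by (rule sgn_oct_def)
  show "dist x y = norm (x - y)" by (rule dist_oct_def)
  show "(Basis :: oct set) \<noteq> {}" by (simp add: Basis_oct_def)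
  show "finite (Basis :: oct set)" by (simp add: Basis_oct_def)
  show "(\<forall>u\<in>Basis. inner x u = 0) = (x = 0)"
    by (simp add: inner_oct_def Basis_oct_def oct_eq_iff ball_Un euclidean_all_zero_iff)
next
  fix u v :: oct
  assume "u \<in> Basis" "v \<in> Basis"
  then show "inner u v = (if u = v then 1 else 0)"
    unfolding Basis_oct_def inner_oct_def by (elim UnE imageE) (simp_all add: inner_Basis, (metis nonzero_Basis)+)
qed (rule uniformity_oct_def open_oct_def)+

end

lemma oct_mult_ocnj: "x * ocnj x = (norm x)\<^sup>2 *\<^sub>R 1"
  by (simp add: oct_eq_iff quat_eq_iff ocnj_def norm_oct_def inner_oct_def inner_quat_def
      power2_eq_square[symmetric] algebra_simps)

lemma inner_quat_mult: "inner (x * y) (x * y) = inner x x * inner y (y :: quat)"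
  unfolding inner_quat_def quat_mult_sel by algebra

lemma inner_quat_exchange:
  "inner (a * c) (d * qcnj b) = inner (qcnj a * d) (c * b)"
  unfolding inner_quat_def quat_mult_sel qcnj_sel by algebra

lemma inner_qcnj: "inner (qcnj x) (qcnj x) = inner x x"
  by (simp add: inner_quat_def)

lemma norm_oct_mult: "norm (x * y) = norm x * norm (y :: oct)"
proof -
  obtain a b c d where xy: "x = Oct a b" "y = Oct c d"
    by (metis oct.exhaust)
  have "inner (x * y) (x * y) =
      inner (a * c) (a * c) + inner (d * qcnj b) (d * qcnj b)
      + inner (qcnj a * d) (qcnj a * d) + inner (c * b) (c * b)
      - 2 * inner (a * c) (d * qcnj b) + 2 * inner (qcnj a * d) (c * b)"
    by (simp only: xy inner_oct_def oct_mult_sel oct.sel inner_add inner_diff inner_commute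
        algebra_simps)
  also have "\<dots> = inner x x * inner y y"
    by (simp add: xy inner_oct_def inner_quat_mult inner_qcnj inner_quat_exchange algebra_simps)
  finally show ?thesis
    by (simp add: norm_oct_def real_sqrt_mult)
qed

section \<open>Slice regular functions on the unit ball\<close>

text \<open>A stem function \<open>F = F1 + i F2\<close> is given by its two octonionic components;
  only their values on the open unit disk matter.\<close>

definition stem_function :: "(complex \<Rightarrow> oct) \<Rightarrow> (complex \<Rightarrow> oct) \<Rightarrow> bool" where
  "stem_function F1 F2 \<longleftrightarrow>
     (\<forall>z\<in>ball 0 1. F1 (cnj z) = F1 z \<and> F2 (cnj z) = - F2 z)"

definition imag_units :: "oct set" where
  "imag_units = {I. I\<^sup>2 = - 1}"

definition induces_slice :: "(complex \<Rightarrow> oct) \<Rightarrow> (complex \<Rightarrow> oct) \<Rightarrow> (oct \<Rightarrow> oct) \<Rightarrow> bool" where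
  "induces_slice F1 F2 f \<longleftrightarrow>
     (\<forall>I\<in>imag_units. \<forall>\<alpha> \<beta>. Complex \<alpha> \<beta> \<in> ball 0 1 \<longrightarrow>
        f (\<alpha> *\<^sub>R 1 + \<beta> *\<^sub>R I) = F1 (Complex \<alpha> \<beta>) + I * F2 (Complex \<alpha> \<beta>))"

definition C1_on :: "complex set \<Rightarrow> (complex \<Rightarrow> oct) \<Rightarrow> bool" where
  "C1_on U g \<longleftrightarrow>
     (\<exists>g' :: complex \<Rightarrow> complex \<Rightarrow>\<^sub>L oct.
        (\<forall>z\<in>U. (g has_derivative blinfun_apply (g' z)) (at z)) \<and> continuous_on U g')"

definition partial_\<alpha> :: "(complex \<Rightarrow> oct) \<Rightarrow> complex \<Rightarrow> oct" where
  "partial_\<alpha> g z = frechet_derivative g (at z) 1"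

definition partial_\<beta> :: "(complex \<Rightarrow> oct) \<Rightarrow> complex \<Rightarrow> oct" where
  "partial_\<beta> g z = frechet_derivative g (at z) \<i>"

definition slice_regular :: "(oct \<Rightarrow> oct) \<Rightarrow> bool" where
  "slice_regular f \<longleftrightarrow>
     (\<exists>F1 F2. stem_function F1 F2 \<and> induces_slice F1 F2 f \<and>
        C1_on (ball 0 1) F1 \<and> C1_on (ball 0 1) F2 \<and>
        (\<forall>z\<in>ball 0 1. partial_\<alpha> F1 z = partial_\<beta> F2 z \<and>
                      partial_\<beta> F1 z = - partial_\<alpha> F2 z))"

definition SRB :: "(oct \<Rightarrow> oct) set" where
  "SRB = {f. slice_regular f \<and> (\<forall>x\<in>ball 0 1. norm (f x) \<le> 1)}"

text \<open>\<open>f x = (\<Sum>k\<ge>m. x ^ k * a k)\<close> on the unit ball; the coefficients \<open>a k\<close> with \<open>k < m\<close> play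
  no role.\<close>

definition power_series_from :: "nat \<Rightarrow> (nat \<Rightarrow> oct) \<Rightarrow> (oct \<Rightarrow> oct) \<Rightarrow> bool" where
  "power_series_from m a f \<longleftrightarrow>
     (\<forall>x\<in>ball 0 1. (\<lambda>j. x ^ (m + j) * a (m + j)) sums f x)"

section \<open>The radius and the weighted sum\<close>

definition is_bohr_radius :: "nat \<Rightarrow> real \<Rightarrow> real \<Rightarrow> bool" where
  "is_bohr_radius m \<gamma> y \<longleftrightarrow> 0 < y \<and> y < 1 \<and>
     y ^ m / (real m + \<gamma>) - 2 * (\<Sum>j. y ^ (m + 1 + j) / (real (m + 1 + j) + \<gamma>)) = 0"

definition bohr_term :: "nat \<Rightarrow> real \<Rightarrow> (nat \<Rightarrow> oct) \<Rightarrow> oct \<Rightarrow> nat \<Rightarrow> real" where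
  "bohr_term m \<gamma> a x j = 1 / (real (m + j) + \<gamma>) * norm (x ^ (m + j) * a (m + j))"

end

theory Submission
  imports Defs "HOL-Complex_Analysis.Complex_Analysis"
begin

text \<open>Everything rests on the coefficient estimate \<open>\<bar>a\<^sub>k\<bar> \<le> 1 - \<bar>a\<^sub>m\<bar>\<^sup>2\<close> for \<open>k > m\<close>. By alternativity, left
  multiplication makes the octonions a complex vector space over each slice, and \<open>f\<close> restricted to a
  slice is a vector-valued holomorphic function. For a suitable slice, depending on \<open>k\<close>, a coordinate of
  this function is a holomorphic function on the disk, bounded by 1, whose coefficients of order \<open>m\<close> and
  \<open>k\<close> have moduli \<open>\<bar>a\<^sub>m\<bar>\<close> and \<open>\<bar>a\<^sub>k\<bar>\<close>; the Schwarz-Pick lemma applies to it. With \<open>A = \<bar>a\<^sub>m\<bar>\<close> and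
  \<open>\<bar>x\<bar> \<le> R\<close> the weighted sum is then at most \<open>(A + (1 - A\<^sup>2) / 2) \<bar>x\<bar>\<^sup>m / (m + \<gamma>) \<le> \<bar>x\<bar>\<^sup>m / (m + \<gamma>)\<close>.
  For sharpness take \<open>f(x) = x\<^sup>m (\<alpha> - x) / (1 - \<alpha> x)\<close> with real \<open>\<alpha>\<close> close to 1.\<close>

section \<open>Octonion arithmetic and slices\<close>

text \<open>The product is not associative, so \<open>oct\<close> is no ring type; distributivity,
  signs and real scalars are taken from this interpretation.\<close>

interpretation oct_mult: bounded_bilinear "(*) :: oct \<Rightarrow> oct \<Rightarrow> oct"
proof
  fix x y z :: oct and r :: real
  show "(x + y) * z = x * z + y * z" "x * (y + z) = x * y + x * z"
    by (simp_all add: oct_eq_iff quat_eq_iff algebra_simps)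
  show "r *\<^sub>R x * y = r *\<^sub>R (x * y)" "x * r *\<^sub>R y = r *\<^sub>R (x * y)"
    by (simp_all add: oct_eq_iff quat_eq_iff algebra_simps)
  show "\<exists>K. \<forall>a b :: oct. norm (a * b) \<le> norm a * norm b * K"
    by (intro exI[of _ 1]) (simp add: norm_oct_mult)
qed

lemma oct_mult_1 [simp]: "1 * x = x" "x * 1 = (x :: oct)"
  by (simp_all add: oct_eq_iff quat_eq_iff)

lemma norm_oct_1 [simp]: "norm (1 :: oct) = 1"
  by (simp add: norm_oct_def inner_oct_def inner_quat_def)

lemma norm_oct_power: "norm (x ^ n) = norm (x :: oct) ^ n"
  by (induction n) (simp_all add: norm_oct_mult)

lemma oct_left_alternative: "x * (x * y) = (x * x) * (y :: oct)"
  by (simp add: oct_eq_iff quat_eq_iff algebra_simps)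

text \<open>Serves as right division by a unit octonion. It survives non-associativity because any
  two octonions generate an associative subalgebra.\<close>

lemma oct_mult_ocnj_cancel: "(x * ocnj u) * u = (norm u)\<^sup>2 *\<^sub>R (x :: oct)"
  by (simp add: oct_eq_iff quat_eq_iff ocnj_def power2_norm_eq_inner inner_oct_def
      inner_quat_def algebra_simps)

text \<open>Polarization of the multiplicativity of the norm.\<close>

lemma inner_oct_mult_left: "inner (x * u) (x * v) = (norm x)\<^sup>2 * inner u (v :: oct)"
proof -
  have "(norm (x * u + x * v))\<^sup>2 = (norm x)\<^sup>2 * (norm (u + v))\<^sup>2"
    by (simp add: norm_oct_mult power_mult_distrib flip: oct_mult.add_right)
  then show ?thesis
    by (simp add: norm_oct_mult power_mult_distrib dot_norm field_simps)
qed

lemma imag_units_square: "I \<in> imag_units \<Longrightarrow> I * I = - 1"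
  by (simp add: imag_units_def numeral_2_eq_2)

lemma imag_units_mult_mult: "I \<in> imag_units \<Longrightarrow> I * (I * v) = - v"
  by (simp add: oct_left_alternative imag_units_square oct_mult.minus_left)

lemma norm_imag_units: "I \<in> imag_units \<Longrightarrow> norm I = 1"
  by (metis imag_units_square norm_oct_mult norm_minus_cancel norm_oct_1 norm_ge_zero
      power2_eq_square real_sqrt_unique real_sqrt_one)

lemma inner_imag_units_mult: "I \<in> imag_units \<Longrightarrow> inner (I * u) (I * v) = inner u v"
  by (simp add: inner_oct_mult_left norm_imag_units)

text \<open>Left multiplication by \<open>I\<close> is an isometry with square \<open>- 1\<close>,
  hence skew-adjoint.\<close>

lemma inner_imag_units_left: "I \<in> imag_units \<Longrightarrow> inner (I * u) v = - inner u (I * v)"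
  using inner_imag_units_mult[of I u "I * v"] by (simp add: imag_units_mult_mult)

lemma inner_self_imag_units: "I \<in> imag_units \<Longrightarrow> inner u (I * u) = 0"
  using inner_imag_units_left[of I u u] by (simp add: inner_commute)

section \<open>Slices as copies of the complex plane, and complex coordinates of octonions\<close>

definition slice_embed :: "oct \<Rightarrow> complex \<Rightarrow> oct" where
  "slice_embed I z = Re z *\<^sub>R 1 + Im z *\<^sub>R I"

lemma bounded_linear_slice_embed: "bounded_linear (slice_embed I)"
  unfolding slice_embed_def
  by (intro bounded_linear_add bounded_linear_scaleR_const bounded_linear_Re bounded_linear_Im)

text \<open>Only products \<open>I * (I * v)\<close> have to be reassociated, and left alternativity
  settles these.\<close>

lemma slice_embed_mult:
  assumes "I \<in> imag_units"
  shows "slice_embed I z * (slice_embed I w * v) = slice_embed I (z * w) * v"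
  by (simp add: slice_embed_def oct_mult.add_left oct_mult.diff_left oct_mult.add_right oct_mult.scaleR_left
      oct_mult.scaleR_right oct_mult.minus_right imag_units_mult_mult[OF assms] algebra_simps)

lemma slice_embed_1 [simp]: "slice_embed I 1 = 1"
  by (simp add: slice_embed_def)

lemma slice_embed_power:
  assumes "I \<in> imag_units"
  shows "slice_embed I z ^ n = slice_embed I (z ^ n)"
  by (induction n) (use slice_embed_mult[OF assms, of z _ 1] in simp_all)

lemma norm_slice_embed:
  assumes "I \<in> imag_units"
  shows "norm (slice_embed I z) = norm z"
proof -
  have "inner 1 I = (0::real)" "inner I 1 = (0::real)"
    using inner_self_imag_units[OF assms, of 1] by (simp_all add: inner_commute)
  moreover have "inner I I = 1" "inner (1::oct) 1 = 1"
    using norm_imag_units[OF assms] norm_oct_1 by (simp_all flip: power2_norm_eq_inner)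
  ultimately have "(norm (slice_embed I z))\<^sup>2 = (norm z)\<^sup>2"
    by (simp add: power2_norm_eq_inner slice_embed_def inner_add_left inner_add_right
        inner_complex_def)
  then show ?thesis by simp
qed

text \<open>Removing the real part leaves a purely imaginary \<open>p\<close>, whose square is minus
  its squared norm; normalizing \<open>p\<close> gives the unit. A real octonion lies in every
  slice, so there an arbitrary unit is chosen.\<close>

lemma oct_in_slice: "\<exists>I z. I \<in> imag_units \<and> x = slice_embed I z"
proof -
  define a where "a = Re0 (ofst x)"
  define p where "p = x - a *\<^sub>R 1"
  have pp: "p * p = - ((norm p)\<^sup>2 *\<^sub>R 1)"
    by (simp add: oct_eq_iff quat_eq_iff p_def a_def power2_norm_eq_inner inner_oct_def
        inner_quat_def algebra_simps)
  show ?thesis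
  proof (cases "p = 0")
    case True
    define I where "I = Oct (Quat 0 1 0 0) 0"
    have "I \<in> imag_units"
      by (simp add: imag_units_def I_def numeral_2_eq_2 oct_eq_iff quat_eq_iff)
    moreover have "x = slice_embed I (of_real a)"
      using True by (simp add: slice_embed_def p_def)
    ultimately show ?thesis by blast
  next
    case False
    define I where "I = p /\<^sub>R norm p"
    have "I * I = - 1"
      using False by (simp add: I_def oct_mult.scaleR_left oct_mult.scaleR_right pp power2_eq_square field_simps)
    then have "I \<in> imag_units"
      by (simp add: imag_units_def numeral_2_eq_2)
    moreover have "x = slice_embed I (Complex a (norm p))"
      using False by (simp add: slice_embed_def I_def p_def)
    ultimately show ?thesis by blast
  qed
qed

text \<open>The coordinate of \<open>v\<close> along \<open>u\<close>, where \<open>oct\<close> is a complex vector space by left multiplication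
  with the slice of \<open>I\<close>; the Hermitian form is linear in \<open>v\<close>.\<close>

definition slice_coord :: "oct \<Rightarrow> oct \<Rightarrow> oct \<Rightarrow> complex" where
  "slice_coord I u v = Complex (inner v u) (inner v (I * u))"

lemma bounded_linear_slice_coord: "bounded_linear (slice_coord I u)"
proof -
  have "slice_coord I u = (\<lambda>v. of_real (inner v u) + of_real (inner v (I * u)) * \<i>)"
    by (auto simp: slice_coord_def complex_eq_iff)
  then show ?thesis
    by (simp only:) (intro bounded_linear_add bounded_linear_const_mult bounded_linear_mult_const
        bounded_linear_of_real[THEN bounded_linear_compose] bounded_linear_inner_left)
qed

text \<open>As \<open>I\<close> is skew-adjoint, replacing \<open>v\<close> by \<open>I * v\<close>
  turns the real pair (p, q) of the coordinate into (-q, p), which is multiplication by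
  \<open>\<i>\<close>.\<close>

lemma slice_coord_mult:
  assumes "I \<in> imag_units"
  shows "slice_coord I u (slice_embed I z * v) = z * slice_coord I u v"
  by (simp add: slice_coord_def slice_embed_def complex_eq_iff oct_mult.add_left
      oct_mult.scaleR_left inner_add_left inner_imag_units_left[OF assms]
      imag_units_mult_mult[OF assms] algebra_simps)

lemma slice_coord_self:
  assumes "I \<in> imag_units" "norm u = 1"
  shows "slice_coord I u u = 1"
  using assms(2) inner_self_imag_units[OF assms(1), of u]
  by (simp add: slice_coord_def complex_eq_iff flip: power2_norm_eq_inner)

text \<open>Bessel's inequality for the orthonormal pair \<open>u\<close>,
  \<open>I * u\<close>.\<close>

lemma norm_slice_coord_le:
  assumes "I \<in> imag_units" "norm u = 1"
  shows "norm (slice_coord I u v) \<le> norm v"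
proof -
  define a b where "a = inner v u" and "b = inner v (I * u)"
  have u: "inner u u = 1" "inner (I * u) (I * u) = 1" "inner u (I * u) = 0" "inner (I * u) u = 0"
    using assms inner_self_imag_units[OF assms(1), of u] inner_imag_units_mult[OF assms(1), of u u]
    by (simp_all add: inner_commute flip: power2_norm_eq_inner)
  have "0 \<le> inner (v - a *\<^sub>R u - b *\<^sub>R (I * u)) (v - a *\<^sub>R u - b *\<^sub>R (I * u))"
    by simp
  also have "\<dots> = inner v v - a\<^sup>2 - b\<^sup>2"
    by (simp add: inner_diff_left inner_diff_right u inner_commute[of u v]
        inner_commute[of "I * u" v] power2_eq_square flip: a_def b_def)
  finally have "(norm (slice_coord I u v))\<^sup>2 \<le> (norm v)\<^sup>2"
    by (simp add: slice_coord_def a_def b_def cmod_power2 power2_norm_eq_inner)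
  then show ?thesis by (simp add: power2_le_iff_abs_le)
qed

section \<open>Coefficients of bounded power series on the disk\<close>

text \<open>Composition with the Moebius map that sends \<open>f 0\<close> to 0 makes the Schwarz
  lemma applicable; it divides the derivative at 0 by
  \<open>1 - (norm (f 0))\<^sup>2\<close>.\<close>

lemma Schwarz_Pick_origin:
  fixes f :: "complex \<Rightarrow> complex"
  assumes holf: "f holomorphic_on ball 0 1" and lt: "\<And>z. norm z < 1 \<Longrightarrow> norm (f z) < 1"
  shows "norm (deriv f 0) \<le> 1 - (norm (f 0))\<^sup>2"
proof -
  define c where "c = f 0"
  define g where "g = (\<lambda>z. (f z - c) / (1 - cnj c * f z))"
  have c: "norm c < 1" using lt[of 0] by (simp add: c_def)
  then have pos: "1 - (norm c)\<^sup>2 > 0" by (simp add: abs_square_less_1)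
  have g_eq: "g = Moebius_function 0 c \<circ> f"
    by (simp add: fun_eq_iff g_def Moebius_function_simple)
  have "g holomorphic_on ball 0 1"
    unfolding g_eq
    by (rule holomorphic_on_compose_gen[OF holf Moebius_function_holomorphic[OF c]])
       (use lt in auto)
  moreover have "norm (g z) < 1" if "norm z < 1" for z
    using Moebius_function_norm_lt_1[OF c lt[OF that]] by (simp add: g_eq)
  moreover have "g 0 = 0" by (simp add: g_def c_def)
  ultimately have "norm (deriv g 0) \<le> 1"
    using Schwarz_Lemma(2)[of g 0] by simp
  moreover have "(g has_field_derivative deriv f 0 / (1 - cnj c * c)) (at 0)"
  proof -
    have "(f has_field_derivative deriv f 0) (at 0)"
      using holomorphic_derivI[OF holf] by simp
    moreover have ne: "1 - cnj c * c \<noteq> 0"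
      using pos by (metis complex_norm_square mult.commute of_real_1 of_real_diff of_real_eq_0_iff less_irrefl)
    ultimately show ?thesis
      unfolding g_def
      by (auto intro!: derivative_eq_intros simp: c_def[symmetric] power2_eq_square)
  qed
  ultimately have "norm (deriv f 0) / norm (1 - cnj c * c) \<le> 1"
    by (simp add: DERIV_imp_deriv norm_divide)
  moreover have "1 - cnj c * c = of_real (1 - (norm c)\<^sup>2)"
    by (metis complex_norm_square mult.commute of_real_1 of_real_diff)
  then have "norm (1 - cnj c * c) = 1 - (norm c)\<^sup>2"
    using pos by (metis abs_of_pos norm_of_real)
  ultimately show ?thesis
    using pos by (simp add: c_def[symmetric] divide_le_eq)
qed

lemma power_series_derivs_0:
  fixes c :: "nat \<Rightarrow> complex"
  assumes "\<And>z. norm z < 1 \<Longrightarrow> (\<lambda>n. c n * z ^ n) sums f z"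
  shows "f holomorphic_on ball 0 1" "f 0 = c 0" "deriv f 0 = c 1"
proof -
  have sums: "(\<lambda>n. c n * (z - 0) ^ n) sums f z" if "z \<in> ball 0 1" for z
    using assms that by simp
  then show hol: "f holomorphic_on ball 0 1"
    by (rule power_series_holomorphic)
  have "(\<lambda>n. c n * 0 ^ n) sums c 0" by (rule powser_sums_zero)
  then show "f 0 = c 0" using assms[of 0] by (simp add: sums_unique2)
  have "((\<lambda>z. \<Sum>n. c n * z ^ n) has_field_derivative (\<Sum>n. diffs c n * 0 ^ n)) (at 0)"
    by (rule termdiffs_strong'[where K = 1]) (use assms in \<open>auto dest: sums_summable\<close>)
  moreover have "(\<Sum>n. diffs c n * 0 ^ n) = c 1"
    by (simp add: diffs_def)
  ultimately have "((\<lambda>z. \<Sum>n. c n * z ^ n) has_field_derivative c 1) (at 0)" by simp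
  then have "(f has_field_derivative c 1) (at 0)"
    by (rule has_field_derivative_transform_within_open[where S = "ball 0 1"])
       (use assms in \<open>auto simp: sums_iff\<close>)
  then show "deriv f 0 = c 1" by (rule DERIV_imp_deriv)
qed

lemma bounded_power_series_coeff_1:
  fixes c :: "nat \<Rightarrow> complex"
  assumes sums: "\<And>z. norm z < 1 \<Longrightarrow> (\<lambda>n. c n * z ^ n) sums f z"
    and le: "\<And>z. norm z < 1 \<Longrightarrow> norm (f z) \<le> 1"
  shows "norm (c 1) \<le> 1 - (norm (c 0))\<^sup>2"
proof -
  \<comment> \<open>Scaling makes the bound strict, which excludes the case \<open>norm (f 0) = 1\<close>.\<close>
  have *: "s * norm (c 1) \<le> 1 - (s * norm (c 0))\<^sup>2" if s: "s < 1" "0 < s" for s :: real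
  proof -
    have sums': "(\<lambda>n. (of_real s * c n) * z ^ n) sums (of_real s * f z)" if "norm z < 1" for z
      using sums_mult[OF sums[OF that], of "of_real s"] by (simp add: mult.assoc)
    have "norm (of_real s * f z) < 1" if "norm z < 1" for z
    proof -
      have "s * norm (f z) \<le> s" using mult_left_mono[OF le[OF that], of s] s by simp
      also have "\<dots> < 1" by (rule s)
      finally show ?thesis using s by (simp add: norm_mult)
    qed
    from Schwarz_Pick_origin[OF power_series_derivs_0(1)[OF sums'] this]
    have "norm (of_real s * c 1) \<le> 1 - (norm (of_real s * c 0))\<^sup>2"
      using power_series_derivs_0(2,3)[OF sums'] by simp
    then show ?thesis using s by (simp add: norm_mult)
  qed
  have "((\<lambda>s. s * norm (c 1)) \<longlongrightarrow> 1 * norm (c 1)) (at_left 1)"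
    "((\<lambda>s. 1 - (s * norm (c 0))\<^sup>2) \<longlongrightarrow> 1 - (1 * norm (c 0))\<^sup>2) (at_left 1)"
    by (intro tendsto_intros)+
  moreover have "eventually (\<lambda>s::real. 0 < s \<and> s < 1) (at_left 1)"
    using eventually_at_left[of 0 "1::real"] by (auto intro!: exI[of _ 0])
  then have "eventually (\<lambda>s. s * norm (c 1) \<le> 1 - (s * norm (c 0))\<^sup>2) (at_left 1)"
    by eventually_elim (use * in auto)
  ultimately show ?thesis
    using tendsto_le[OF trivial_limit_at_left_real] by fastforce
qed

text \<open>A geometric sum with ratio \<open>\<omega> ^ n\<close>, a \<open>k\<close>-th root of
  unity that equals 1 exactly when \<open>k dvd n\<close>.\<close>

lemma sum_roots_of_unity_power:
  fixes k n :: nat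
  assumes "k > 0"
  defines "\<omega> \<equiv> exp (2 * of_real pi * \<i> / of_nat k)"
  shows "(\<Sum>j<k. (\<omega> ^ j) ^ n) = (if k dvd n then of_nat k else 0)"
proof -
  have pow: "\<omega> ^ n = exp (2 * of_real pi * \<i> * of_nat n / of_nat k)" for n
    by (simp add: \<omega>_def exp_of_nat_mult[symmetric] mult_ac)
  have eq1: "\<omega> ^ n = 1 \<longleftrightarrow> k dvd n"
    using complex_root_unity_eq_1[of k n] assms(1) by (simp add: pow)
  have "(\<Sum>j<k. (\<omega> ^ j) ^ n) = (\<Sum>j<k. (\<omega> ^ n) ^ j)"
    by (simp add: power_mult[symmetric] mult.commute)
  also have "\<dots> = (if k dvd n then of_nat k else 0)"
  proof (cases "k dvd n")
    case True
    then show ?thesis using eq1 by simp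
  next
    case False
    have "\<omega> ^ k = 1" using assms(1) by (simp add: pow)
    then have "(\<omega> ^ n) ^ k = 1" by (metis power_mult mult.commute power_one)
    then show ?thesis using False eq1 by (simp add: geometric_sum)
  qed
  finally show ?thesis .
qed

text \<open>Averaging over the rotations by \<open>k\<close>-th roots of unity reduces the \<open>k\<close>-th coefficient to the
  first one.\<close>

lemma bounded_power_series_coeff:
  fixes c :: "nat \<Rightarrow> complex"
  assumes sums: "\<And>z. norm z < 1 \<Longrightarrow> (\<lambda>n. c n * z ^ n) sums f z"
    and le: "\<And>z. norm z < 1 \<Longrightarrow> norm (f z) \<le> 1" and k: "k > 0"
  shows "norm (c k) \<le> 1 - (norm (c 0))\<^sup>2"
proof -
  define \<omega> where "\<omega> = exp (2 * of_real pi * \<i> / of_nat k)"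
  have norm_\<omega>: "norm (\<omega> ^ j) = 1" for j
    by (simp add: \<omega>_def norm_power)
  \<comment> \<open>Keeps every \<open>k\<close>-th coefficient, so that \<open>g (z ^ k)\<close> is
    the average of \<open>f\<close> over the points \<open>\<omega> ^ j * z\<close> and inherits its
    bound.\<close>
  define g where "g w = (\<Sum>n. c (k * n) * w ^ n)" for w
  have *: "(\<lambda>n. c (k * n) * w ^ n) sums g w \<and> norm (g w) \<le> 1" if w: "norm w < 1" for w
  proof -
    obtain z where z: "z ^ k = w"
      using exists_complex_root[of k w] k by blast
    have nz: "norm z < 1"
      using w one_le_power[of "norm z" k] unfolding z[symmetric] norm_power by linarith
    define S where "S = (\<Sum>j<k. f (\<omega> ^ j * z)) / of_nat k"
    have nz': "norm (\<omega> ^ j * z) < 1" for j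
      using nz by (simp add: norm_mult norm_\<omega>)
    have "(\<lambda>n. (\<Sum>j<k. c n * (\<omega> ^ j * z) ^ n) / of_nat k) sums S"
      unfolding S_def by (intro sums_divide sums_sum sums nz')
    moreover have "(\<Sum>j<k. c n * (\<omega> ^ j * z) ^ n) / of_nat k = (if k dvd n then c n * z ^ n else 0)" for n
    proof -
      have "(\<Sum>j<k. c n * (\<omega> ^ j * z) ^ n) = c n * z ^ n * (\<Sum>j<k. (\<omega> ^ j) ^ n)"
        by (simp add: sum_distrib_left power_mult_distrib mult_ac)
      then show ?thesis
        using sum_roots_of_unity_power[OF k, of n] k by (simp add: \<omega>_def)
    qed
    ultimately have "(\<lambda>n. if k dvd n then c n * z ^ n else 0) sums S" by simp
    \<comment> \<open>Nonzero terms occur only at multiples of \<open>k\<close>, so the series can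
      be reindexed along them.\<close>
    moreover have "strict_mono (\<lambda>n. k * n)"
      using k by (simp add: strict_mono_def)
    ultimately have "(\<lambda>n. if k dvd k * n then c (k * n) * z ^ (k * n) else 0) sums S"
      by (subst sums_mono_reindex) auto
    then have S: "(\<lambda>n. c (k * n) * w ^ n) sums S"
      by (simp add: power_mult z)
    have "norm (\<Sum>j<k. f (\<omega> ^ j * z)) \<le> (\<Sum>j<k. 1)"
      by (intro sum_norm_le le nz')
    then have "norm S \<le> 1"
      using k by (simp add: S_def norm_divide)
    with S show ?thesis by (simp add: g_def sums_iff)
  qed
  \<comment> \<open>The coefficients of \<open>g\<close> of order 0 and 1 are \<open>c 0\<close> and
    \<open>c k\<close>.\<close>
  have "norm (c (k * 1)) \<le> 1 - (norm (c (k * 0)))\<^sup>2"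
    by (rule bounded_power_series_coeff_1[of "\<lambda>n. c (k * n)" g]) (use * in auto)
  then show ?thesis by simp
qed

text \<open>On the circle of radius \<open>r\<close> the factor \<open>z ^ m\<close> has modulus
  \<open>r ^ m\<close>, so the maximum principle bounds \<open>f\<close> inside by
  \<open>1 / r ^ m\<close>; then \<open>r\<close> tends to 1.\<close>

lemma norm_le_1_if_norm_power_mult_le_1:
  fixes f :: "complex \<Rightarrow> complex"
  assumes hol: "f holomorphic_on ball 0 1"
    and le: "\<And>z. norm z < 1 \<Longrightarrow> norm (z ^ m * f z) \<le> 1" and w: "norm w < 1"
  shows "norm (f w) \<le> 1"
proof -
  have *: "norm (f w) \<le> 1 / r ^ m" if r: "norm w < r" "r < 1" for r
  proof (rule maximum_modulus_frontier[of f "cball 0 r"])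
    have r0: "r > 0" using r norm_ge_zero[of w] by linarith
    show "f holomorphic_on interior (cball 0 r)"
      using r by (intro holomorphic_on_subset[OF hol]) auto
    show "continuous_on (closure (cball 0 r)) f"
      using r by (intro continuous_on_subset[OF holomorphic_on_imp_continuous_on[OF hol]]) auto
    show "w \<in> cball 0 r" using r by simp
    show "norm (f z) \<le> 1 / r ^ m" if "z \<in> frontier (cball 0 r)" for z
      using that le[of z] r r0 by (simp add: norm_mult norm_power field_simps)
  qed simp
  have "((\<lambda>r. 1 / r ^ m) \<longlongrightarrow> 1 / 1 ^ m) (at_left (1::real))"
    by (intro tendsto_intros) auto
  moreover have "eventually (\<lambda>r. norm w < r \<and> r < 1) (at_left 1)"
    using w eventually_at_left[of "norm w" "1::real"] by auto
  then have "eventually (\<lambda>r. norm (f w) \<le> 1 / r ^ m) (at_left 1)"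
    by eventually_elim (use * in auto)
  ultimately show ?thesis
    using tendsto_lowerbound[OF _ _ trivial_limit_at_left_real] by fastforce
qed

text \<open>Dividing by \<open>z ^ m\<close> leaves a series with constant term \<open>c m\<close>
  that is still bounded by 1.\<close>

lemma bounded_power_series_from_coeff:
  fixes c :: "nat \<Rightarrow> complex"
  assumes sums: "\<And>z. norm z < 1 \<Longrightarrow> (\<lambda>n. z ^ (m + n) * c (m + n)) sums f z"
    and le: "\<And>z. norm z < 1 \<Longrightarrow> norm (f z) \<le> 1" and k: "k > 0"
  shows "norm (c (m + k)) \<le> 1 - (norm (c m))\<^sup>2"
proof -
  define d where "d = (\<lambda>n. c (m + n))"
  define g where "g z = (\<Sum>n. d n * z ^ n)" for z
  have g: "(\<lambda>n. d n * z ^ n) sums g z" if "norm z < 1" for z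
  proof -
    have "summable (\<lambda>n. d n * z ^ n)"
    \<comment> \<open>Cancelling \<open>z ^ m\<close> needs \<open>z\<close> nonzero; at 0 every
      power series converges.\<close>
    proof (cases "z = 0")
      case False
      have "summable (\<lambda>n. z ^ m * (d n * z ^ n))"
        using sums_summable[OF sums[OF that]] by (simp add: d_def power_add mult_ac)
      then show ?thesis using False by (simp add: summable_cmult_iff)
    qed (simp add: summable_0_powser)
    then show ?thesis unfolding g_def by (rule summable_sums)
  qed
  have "f z = z ^ m * g z" if "norm z < 1" for z
    using sums[OF that] sums_mult[OF g[OF that], of "z ^ m"]
    by (intro sums_unique2) (simp_all add: d_def power_add mult_ac)
  then have "norm (z ^ m * g z) \<le> 1" if "norm z < 1" for z
    using le that by metis
  then have "norm (g z) \<le> 1" if "norm z < 1" for z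
    using norm_le_1_if_norm_power_mult_le_1[OF power_series_derivs_0(1)[OF g]] that by blast
  from bounded_power_series_coeff[OF g this k] show ?thesis by (simp add: d_def)
qed

text \<open>The slice is chosen to contain \<open>a (m + j) * ocnj u\<close>, where \<open>a m\<close> is a nonnegative multiple of
  the unit vector \<open>u\<close>. Then projecting to the complex line through \<open>u\<close> loses no part of
  \<open>a m\<close> or \<open>a (m + j)\<close>.\<close>

lemma power_series_coeff_bound:
  assumes ps: "power_series_from m a f" and le: "\<And>x. x \<in> ball 0 1 \<Longrightarrow> norm (f x) \<le> 1"
    and j: "j > 0"
  shows "norm (a (m + j)) \<le> 1 - (norm (a m))\<^sup>2"
proof -
  obtain u where u: "norm u = 1" "a m = norm (a m) *\<^sub>R u"
  proof (cases "a m = 0")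
    \<comment> \<open>Any unit vector serves when \<open>a m\<close> vanishes.\<close>
    case True
    then show ?thesis using that[of 1] by simp
  next
    case False
    then show ?thesis using that[of "a m /\<^sub>R norm (a m)"] by simp
  qed
  obtain I w where I: "I \<in> imag_units" and w: "a (m + j) * ocnj u = slice_embed I w"
    using oct_in_slice by blast
  have aj: "a (m + j) = slice_embed I w * u"
    using oct_mult_ocnj_cancel[of "a (m + j)" u] u(1) by (simp add: w)
  interpret P: bounded_linear "slice_coord I u" by (rule bounded_linear_slice_coord)
  have ball: "slice_embed I z \<in> ball 0 1" if "norm z < 1" for z
    using that I by (simp add: norm_slice_embed)
  \<comment> \<open>Continuity and complex linearity of the coordinate turn the series on the slice
    into a scalar power series.\<close>
  have "(\<lambda>n. z ^ (m + n) * slice_coord I u (a (m + n))) sums slice_coord I u (f (slice_embed I z))"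
    if "norm z < 1" for z
    using P.sums[OF ps[unfolded power_series_from_def, rule_format, OF ball[OF that]]]
    by (simp only: slice_embed_power[OF I] slice_coord_mult[OF I])
  moreover have "norm (slice_coord I u (f (slice_embed I z))) \<le> 1" if "norm z < 1" for z
    using norm_slice_coord_le[OF I u(1)] le[OF ball[OF that]] by (rule order_trans)
  ultimately have "norm (slice_coord I u (a (m + j))) \<le> 1 - (norm (slice_coord I u (a m)))\<^sup>2"
    using j by (rule bounded_power_series_from_coeff)
  \<comment> \<open>The coordinate of \<open>a m\<close> is \<open>norm (a m)\<close>; that of
    \<open>a (m + j)\<close> is \<open>w\<close>, of modulus
    \<open>norm (a (m + j))\<close>.\<close>
  moreover have "norm (slice_coord I u (a m)) = norm (a m)"
    by (subst u(2)) (simp add: P.scaleR slice_coord_self[OF I u(1)])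
  moreover have "norm (slice_coord I u (a (m + j))) = norm (a (m + j))"
    by (simp add: aj slice_coord_mult[OF I] slice_coord_self[OF I u(1)] norm_oct_mult
        norm_slice_embed[OF I] u(1))
  ultimately show ?thesis by simp
qed

section \<open>The Bohr radius\<close>

text \<open>The sum of \<open>y ^ k / (s + k)\<close> over \<open>k \<ge> 1\<close>. For
  \<open>s = m + \<gamma>\<close> it is the tail of the radius equation divided by
  \<open>y ^ m\<close>, so the equation becomes \<open>bohr_tail s y = 1 / (2 * s)\<close>.\<close>

definition bohr_tail :: "real \<Rightarrow> real \<Rightarrow> real" where
  "bohr_tail s y = y * (\<Sum>j. 1 / (s + 1 + real j) * y ^ j)"

lemma summable_bohr_tail:
  fixes y :: real
  assumes "s > 0" "\<bar>y\<bar> < 1"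
  shows "summable (\<lambda>j. 1 / (s + 1 + real j) * y ^ j)"
proof (rule summable_comparison_test')
  show "summable (\<lambda>j. \<bar>y\<bar> ^ j)" using assms by simp
  show "norm (1 / (s + 1 + real j) * y ^ j) \<le> \<bar>y\<bar> ^ j" for j
    using assms mult_right_mono[of "1 / (s + 1 + real j)" 1 "\<bar>y\<bar> ^ j"]
    by (simp add: abs_mult power_abs)
qed

text \<open>Positive coefficients make the series nondecreasing and positive; the leading factor
  \<open>y\<close> makes the growth strict.\<close>

lemma bohr_tail_strict_mono:
  assumes s: "s > 0" and y: "0 \<le> y1" "y1 < y2" "y2 < 1"
  shows "bohr_tail s y1 < bohr_tail s y2"
proof -
  let ?h = "\<lambda>y. \<Sum>j. 1 / (s + 1 + real j) * y ^ j"
  have "?h y1 \<le> ?h y2"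
    using s y by (intro suminf_le summable_bohr_tail mult_left_mono power_mono) auto
  moreover have "?h y2 > 0"
    using s y by (intro suminf_pos2[of _ 0] summable_bohr_tail) auto
  ultimately have "y1 * ?h y1 \<le> y1 * ?h y2" "y1 * ?h y2 < y2 * ?h y2"
    using y by (auto intro: mult_left_mono)
  then show ?thesis by (simp add: bohr_tail_def)
qed

lemma isCont_bohr_tail:
  assumes s: "s > 0" and y: "\<bar>y\<bar> < 1"
  shows "isCont (bohr_tail s) y"
proof -
  \<comment> \<open>A point strictly between \<open>\<bar>y\<bar>\<close> and 1, where the series
    still converges.\<close>
  define K where "K = (1 + \<bar>y\<bar>) / 2"
  have "\<bar>K\<bar> < 1" "\<bar>y\<bar> < \<bar>K\<bar>" using y by (auto simp: K_def)
  then have "isCont (\<lambda>y. \<Sum>j. 1 / (s + 1 + real j) * y ^ j) y"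
    using isCont_powser[OF summable_bohr_tail[OF s], of K y] by simp
  then show ?thesis
    unfolding bohr_tail_def[abs_def] by (intro continuous_intros)
qed

text \<open>The coefficients have a divergent sum, so a partial sum exceeds \<open>C\<close> at
  \<open>y = 1\<close> and, by continuity, slightly below 1, where the full series dominates
  it.\<close>

lemma bohr_tail_unbounded:
  assumes s: "s > 0"
  shows "\<exists>y. 0 < y \<and> y < 1 \<and> bohr_tail s y > C"
proof -
  define b where "b j = 1 / (s + 1 + real j)" for j
  have b: "b j > 0" for j using s by (simp add: b_def add_pos_nonneg)
  have "\<not> summable b"
  proof
    assume "summable b"
    then have "summable (\<lambda>j. (s + 1) * b j)" by (rule summable_mult)
    \<comment> \<open>Comparison with the harmonic series, from
      \<open>s + 1 + j \<le> (s + 1) * (j + 1)\<close>.\<close>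
    moreover have "norm (inverse (real (Suc j))) \<le> (s + 1) * b j" for j
      using s by (simp add: b_def divide_simps algebra_simps)
    ultimately have "summable (\<lambda>j. inverse (real (Suc j)))"
      by (rule summable_comparison_test'[where N = 0])
    then show False
      using not_summable_harmonic[where 'a = real] summable_Suc_iff[of "\<lambda>j. inverse (real j)"]
      by simp
  qed
  then obtain N where N: "(\<Sum>j<N. b j) > C"
    using summableI_nonneg_bounded[of b C] b by (meson less_imp_le not_le)
  have "((\<lambda>y. y * (\<Sum>j<N. b j * y ^ j)) \<longlongrightarrow> 1 * (\<Sum>j<N. b j * 1 ^ j)) (at_left 1)"
    by (intro tendsto_intros)
  then have "eventually (\<lambda>y. y * (\<Sum>j<N. b j * y ^ j) > C) (at_left 1)"
    using N by (intro order_tendstoD) auto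
  moreover have "eventually (\<lambda>y::real. 0 < y \<and> y < 1) (at_left 1)"
    using eventually_at_left[of 0 "1::real"] by (auto intro!: exI[of _ 0])
  ultimately have "eventually (\<lambda>y. 0 < y \<and> y < 1 \<and> y * (\<Sum>j<N. b j * y ^ j) > C) (at_left 1)"
    by eventually_elim auto
  then obtain y where y: "0 < y" "y < 1" "y * (\<Sum>j<N. b j * y ^ j) > C"
    using eventually_happens'[OF trivial_limit_at_left_real] by blast
  have "(\<Sum>j<N. b j * y ^ j) \<le> (\<Sum>j. b j * y ^ j)"
    using y b summable_bohr_tail[OF s, of y]
    by (intro sum_le_suminf) (auto simp: b_def less_imp_le)
  then have "y * (\<Sum>j<N. b j * y ^ j) \<le> bohr_tail s y"
    using y by (simp add: bohr_tail_def b_def)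
  then show ?thesis using y by (intro exI[of _ y]) linarith
qed

text \<open>The intermediate value theorem gives existence, strict monotonicity uniqueness.\<close>

lemma bohr_tail_ex1:
  assumes s: "s > 0" and C: "C > 0"
  shows "\<exists>!y. 0 < y \<and> y < 1 \<and> bohr_tail s y = C"
proof -
  obtain Y where Y: "0 < Y" "Y < 1" "bohr_tail s Y > C"
    using bohr_tail_unbounded[OF s] by blast
  have "\<exists>y\<ge>0. y \<le> Y \<and> bohr_tail s y = C"
    using s C Y by (intro IVT) (auto simp: bohr_tail_def[of s 0] intro!: isCont_bohr_tail)
  then obtain y where y: "0 \<le> y" "y \<le> Y" "bohr_tail s y = C" by blast
  have "y \<noteq> 0" using y(3) C by (auto simp: bohr_tail_def)
  show ?thesis
  proof (rule ex1I[of _ y])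
    show "0 < y \<and> y < 1 \<and> bohr_tail s y = C" using y Y \<open>y \<noteq> 0\<close> by simp
    show "y' = y" if "0 < y' \<and> y' < 1 \<and> bohr_tail s y' = C" for y'
      using that y Y bohr_tail_strict_mono[OF s, of y y'] bohr_tail_strict_mono[OF s, of y' y]
      by (cases y y' rule: linorder_cases) auto
  qed
qed

lemma is_bohr_radius_iff:
  assumes "real m + \<gamma> > 0"
  shows "is_bohr_radius m \<gamma> y \<longleftrightarrow>
    0 < y \<and> y < 1 \<and> bohr_tail (real m + \<gamma>) y = 1 / (2 * (real m + \<gamma>))"
proof -
  have "y ^ m / (real m + \<gamma>) - 2 * (\<Sum>j. y ^ (m + 1 + j) / (real (m + 1 + j) + \<gamma>))
      = y ^ m * (1 / (real m + \<gamma>) - 2 * bohr_tail (real m + \<gamma>) y)" if y: "0 < y" "y < 1"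
  proof -
    have "(\<Sum>j. y ^ (m + 1 + j) / (real (m + 1 + j) + \<gamma>))
        = (\<Sum>j. y ^ m * y * (1 / (real m + \<gamma> + 1 + real j) * y ^ j))"
      by (simp add: power_add add_ac mult_ac)
    also have "\<dots> = y ^ m * bohr_tail (real m + \<gamma>) y"
      using suminf_mult[OF summable_bohr_tail[OF assms, of y], of "y ^ m * y"] y
      by (simp add: bohr_tail_def)
    finally show ?thesis by (simp add: algebra_simps)
  qed
  then have "is_bohr_radius m \<gamma> y \<longleftrightarrow>
      0 < y \<and> y < 1 \<and> 1 / (real m + \<gamma>) - 2 * bohr_tail (real m + \<gamma>) y = 0"
    unfolding is_bohr_radius_def by auto
  then show ?thesis using assms by (auto simp: field_simps)
qed

section \<open>The Bohr inequality within the radius\<close>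

lemma bohr_sum_le:
  assumes s: "real m + \<gamma> > 0" and r: "norm x < 1"
    and tail: "bohr_tail (real m + \<gamma>) (norm x) \<le> 1 / (2 * (real m + \<gamma>))"
    and coeff: "\<And>j. j > 0 \<Longrightarrow> norm (a (m + j)) \<le> 1 - (norm (a m))\<^sup>2"
  shows "summable (bohr_term m \<gamma> a x) \<and>
    (\<Sum>j. bohr_term m \<gamma> a x j) \<le> 1 / (real m + \<gamma>) * norm x ^ m"
proof -
  define s where "s = real m + \<gamma>"
  define r where "r = norm x"
  define A where "A = norm (a m)"
  \<comment> \<open>The common factor of all terms beyond the first, once the coefficient estimate
    is applied.\<close>
  define B where "B = (1 - A\<^sup>2) * r ^ m * r"
  have s0: "s > 0" and r0: "0 \<le> r" "r < 1" using s r by (auto simp: s_def r_def)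
  \<comment> \<open>The estimate for \<open>a (m + 1)\<close> already forces
    \<open>A \<le> 1\<close>.\<close>
  have A: "0 \<le> 1 - A\<^sup>2"
    using coeff[of 1] norm_ge_zero[of "a (m + 1)"] unfolding A_def by linarith
  have le: "bohr_term m \<gamma> a x (Suc j) \<le> B * (1 / (s + 1 + real j) * r ^ j)" for j
  proof -
    have "bohr_term m \<gamma> a x (Suc j)
        = norm (a (m + Suc j)) * (r ^ m * r * (1 / (s + 1 + real j) * r ^ j))"
      by (simp add: bohr_term_def norm_oct_mult norm_oct_power r_def s_def power_add add_ac)
    also have "\<dots> \<le> (1 - A\<^sup>2) * (r ^ m * r * (1 / (s + 1 + real j) * r ^ j))"
      using coeff[of "Suc j"] r0 s0 by (intro mult_right_mono) (auto simp: A_def)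
    finally show ?thesis by (simp add: B_def mult_ac)
  qed
  have nonneg: "0 \<le> bohr_term m \<gamma> a x j" for j
    using s0 by (simp add: bohr_term_def s_def)
  have sm: "summable (\<lambda>j. B * (1 / (s + 1 + real j) * r ^ j))"
    using s0 r0 by (intro summable_mult summable_bohr_tail) auto
  have sm': "summable (\<lambda>j. bohr_term m \<gamma> a x (Suc j))"
    by (rule summable_comparison_test'[OF sm, of 0]) (use le nonneg in simp)
  then have summable: "summable (bohr_term m \<gamma> a x)" by (simp add: summable_Suc_iff)
  have "bohr_term m \<gamma> a x 0 = A * r ^ m / s"
    by (simp add: bohr_term_def norm_oct_mult norm_oct_power r_def s_def A_def)
  then have "(\<Sum>j. bohr_term m \<gamma> a x j) = (\<Sum>j. bohr_term m \<gamma> a x (Suc j)) + A * r ^ m / s"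
    using suminf_split_head[OF summable] by simp
  also have "(\<Sum>j. bohr_term m \<gamma> a x (Suc j)) \<le> (\<Sum>j. B * (1 / (s + 1 + real j) * r ^ j))"
    by (rule suminf_le[OF le sm' sm])
  also have "\<dots> = (1 - A\<^sup>2) * r ^ m * bohr_tail s r"
    using suminf_mult[OF summable_bohr_tail[OF s0, of r], of B] r0
    by (simp add: B_def bohr_tail_def)
  also have "\<dots> \<le> (1 - A\<^sup>2) * r ^ m * (1 / (2 * s))"
    using tail A r0 by (intro mult_left_mono) (auto simp: s_def r_def)
  \<comment> \<open>Completing the square:
    \<open>A + (1 - A\<^sup>2) / 2 = 1 - (1 - A)\<^sup>2 / 2\<close>.\<close>
  also have "(1 - A\<^sup>2) * r ^ m * (1 / (2 * s)) + A * r ^ m / s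
      = 1 / s * r ^ m - (1 - A)\<^sup>2 * r ^ m / (2 * s)"
    using s0 by (simp add: field_simps power2_eq_square)
  also have "\<dots> \<le> 1 / s * r ^ m"
    using s0 r0 by simp
  finally show ?thesis using summable by (simp add: s_def r_def)
qed

section \<open>Blaschke factors as extremal functions\<close>

lemma holomorphic_linear_has_derivative:
  assumes hol: "\<phi> holomorphic_on ball 0 1" and L: "bounded_linear L" and z: "z \<in> ball 0 1"
  shows "((\<lambda>z. L (\<phi> z)) has_derivative (\<lambda>h. L (deriv \<phi> z * h))) (at z)"
proof -
  have "(\<phi> has_derivative (\<lambda>h. deriv \<phi> z * h)) (at z)"
    using holomorphic_derivI[OF hol _ z, of UNIV] by (simp add: has_field_derivative_def)
  then show ?thesis by (rule bounded_linear.has_derivative[OF L])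
qed

lemma holomorphic_linear_C1_on:
  fixes L :: "complex \<Rightarrow> oct"
  assumes hol: "\<phi> holomorphic_on ball 0 1" and L: "bounded_linear L"
  shows "C1_on (ball 0 1) (\<lambda>z. L (\<phi> z))"
proof -
  \<comment> \<open>Multiplication by \<open>deriv \<phi> z\<close> followed by \<open>L\<close>;
    its continuity in \<open>z\<close> reduces to that of \<open>deriv \<phi>\<close>.\<close>
  let ?g' = "\<lambda>z. Blinfun L o\<^sub>L blinfun_mult_right (deriv \<phi> z)"
  have "continuous_on (ball 0 1) (deriv \<phi>)"
    using hol by (intro holomorphic_on_imp_continuous_on holomorphic_deriv) auto
  then have "continuous_on (ball 0 1) ?g'"
    by (intro bounded_bilinear.continuous_on[OF bounded_bilinear_blinfun_compose]
        continuous_intros bounded_linear.continuous_on[OF bounded_linear_blinfun_mult_right])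
  moreover have "blinfun_apply (?g' z) = (\<lambda>h. L (deriv \<phi> z * h))" for z
    by (simp add: fun_eq_iff bounded_linear_Blinfun_apply[OF L])
  ultimately show ?thesis
    unfolding C1_on_def using holomorphic_linear_has_derivative[OF hol L]
    by (intro exI[of _ ?g']) simp
qed

text \<open>Real coefficients make \<open>\<phi>\<close> commute with conjugation, so its real and
  imaginary parts, as multiples of 1, form a stem function. On each slice \<open>f\<close> is a copy
  of \<open>\<phi>\<close> with the same norm.\<close>

lemma ex_SRB_real_coeffs:
  fixes \<phi> :: "complex \<Rightarrow> complex" and d :: "nat \<Rightarrow> real"
  assumes hol: "\<phi> holomorphic_on ball 0 1"
    and sums: "\<And>z. norm z < 1 \<Longrightarrow> (\<lambda>j. of_real (d j) * z ^ (m + j)) sums \<phi> z"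
    and le: "\<And>z. norm z < 1 \<Longrightarrow> norm (\<phi> z) \<le> 1"
  shows "\<exists>f\<in>SRB. power_series_from m (\<lambda>k. d (k - m) *\<^sub>R 1) f"
proof -
  define f :: "oct \<Rightarrow> oct" where "f x = (\<Sum>j. x ^ (m + j) * (d j *\<^sub>R 1))" for x
  have sums_f: "(\<lambda>j. slice_embed I z ^ (m + j) * (d j *\<^sub>R 1)) sums slice_embed I (\<phi> z)"
    if I: "I \<in> imag_units" and z: "norm z < 1" for I z
  proof -
    interpret E: bounded_linear "slice_embed I" by (rule bounded_linear_slice_embed)
    show ?thesis
      using E.sums[OF sums[OF z]]
      by (simp add: slice_embed_power[OF I] oct_mult.scaleR_right E.scaleR flip: scaleR_conv_of_real)
  qed
  then have f_eq: "f (slice_embed I z) = slice_embed I (\<phi> z)"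
    if "I \<in> imag_units" "norm z < 1" for I z
    using that by (simp add: f_def sums_iff)
  have slice: "\<exists>I z. I \<in> imag_units \<and> norm z < 1 \<and> x = slice_embed I z" if "x \<in> ball 0 1" for x
  proof -
    obtain I z where "I \<in> imag_units" "x = slice_embed I z"
      using oct_in_slice by blast
    moreover from this that have "norm z < 1" by (simp add: norm_slice_embed)
    ultimately show ?thesis by blast
  qed
  have "power_series_from m (\<lambda>k. d (k - m) *\<^sub>R 1) f"
    unfolding power_series_from_def using slice sums_f f_eq by fastforce
  moreover have "norm (f x) \<le> 1" if "x \<in> ball 0 1" for x
    using slice[OF that] f_eq le by (auto simp: norm_slice_embed)
  moreover have "slice_regular f"
  proof -
    define F1 F2 where "F1 = (\<lambda>z. Re (\<phi> z) *\<^sub>R (1 :: oct))" and "F2 = (\<lambda>z. Im (\<phi> z) *\<^sub>R (1 :: oct))"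
    have cnj: "\<phi> (cnj z) = cnj (\<phi> z)" if "norm z < 1" for z
    proof -
      have "(\<lambda>j. cnj (of_real (d j) * z ^ (m + j))) sums cnj (\<phi> z)"
        using sums[OF that] by (simp only: sums_cnj)
      then show ?thesis using sums[of "cnj z"] that by (simp add: sums_unique2)
    qed
    have L: "bounded_linear (\<lambda>w. Re w *\<^sub>R (1 :: oct))" "bounded_linear (\<lambda>w. Im w *\<^sub>R (1 :: oct))"
      by (intro bounded_linear_scaleR_const bounded_linear_Re bounded_linear_Im)+
    have "stem_function F1 F2"
      by (simp add: stem_function_def F1_def F2_def cnj)
    moreover have "induces_slice F1 F2 f"
      unfolding induces_slice_def
    proof (intro ballI allI impI)
      fix I \<alpha> \<beta> assume I: "I \<in> imag_units" and z: "Complex \<alpha> \<beta> \<in> ball 0 1"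
      then show "f (\<alpha> *\<^sub>R 1 + \<beta> *\<^sub>R I) = F1 (Complex \<alpha> \<beta>) + I * F2 (Complex \<alpha> \<beta>)"
        using f_eq[OF I, of "Complex \<alpha> \<beta>"]
        by (simp add: slice_embed_def F1_def F2_def oct_mult.scaleR_right)
    qed
    moreover have "C1_on (ball 0 1) F1" "C1_on (ball 0 1) F2"
      unfolding F1_def F2_def by (intro holomorphic_linear_C1_on hol L)+
    \<comment> \<open>The derivative of \<open>\<phi>\<close> in direction \<open>\<i>\<close> is
      \<open>deriv \<phi> z * \<i>\<close>; its real and imaginary parts give both
      equations.\<close>
    moreover have "partial_\<alpha> F1 z = partial_\<beta> F2 z \<and> partial_\<beta> F1 z = - partial_\<alpha> F2 z"
      if "z \<in> ball 0 1" for z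
      using holomorphic_linear_has_derivative[OF hol L(1) that]
        holomorphic_linear_has_derivative[OF hol L(2) that]
      by (simp add: partial_\<alpha>_def partial_\<beta>_def F1_def F2_def flip: frechet_derivative_at)
    ultimately show ?thesis unfolding slice_regular_def by blast
  qed
  ultimately show ?thesis unfolding SRB_def by blast
qed

text \<open>\<open>d\<close> lists the Taylor coefficients of \<open>(\<alpha> - z) / (1 - \<alpha>
  * z) = \<alpha> - (1 - \<alpha>\<^sup>2) * z / (1 - \<alpha> * z)\<close>.\<close>

lemma ex_SRB_Blaschke:
  fixes \<alpha> :: real and m :: nat
  assumes \<alpha>: "0 < \<alpha>" "\<alpha> < 1"
  defines "d \<equiv> \<lambda>j. case j of 0 \<Rightarrow> \<alpha> | Suc i \<Rightarrow> - (1 - \<alpha>\<^sup>2) * \<alpha> ^ i"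
  shows "\<exists>f\<in>SRB. power_series_from m (\<lambda>k. d (k - m) *\<^sub>R 1) f"
proof (rule ex_SRB_real_coeffs)
  \<comment> \<open>This is \<open>(z - \<alpha>) / (1 - \<alpha> * z)\<close>, whence the minus
    signs below.\<close>
  define \<psi> where "\<psi> = Moebius_function 0 (of_real \<alpha>)"
  have norm: "norm (of_real \<alpha> :: complex) < 1" using \<alpha> by simp
  show "(\<lambda>z. - (z ^ m * \<psi> z)) holomorphic_on ball 0 1"
    unfolding \<psi>_def by (intro holomorphic_intros Moebius_function_holomorphic norm)
  fix z :: complex assume z: "norm z < 1"
  show "norm (- (z ^ m * \<psi> z)) \<le> 1"
    using Moebius_function_norm_lt_1[OF norm z, of 0] z
    by (simp add: \<psi>_def norm_mult norm_power mult_le_one power_le_one)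
  have az: "norm (of_real \<alpha> * z) < 1"
    using norm z norm_mult_less[of "of_real \<alpha> :: complex" 1 z 1] by simp
  have ne: "1 - of_real \<alpha> * z \<noteq> 0" using az by auto
  have "(\<lambda>i. - (1 - of_real \<alpha> ^ 2) * z * (of_real \<alpha> * z) ^ i)
      sums (- (1 - of_real \<alpha> ^ 2) * z * (1 / (1 - of_real \<alpha> * z)))"
    by (intro sums_mult geometric_sums az)
  then have "(\<lambda>i. of_real (d (Suc i)) * z ^ Suc i)
      sums (- (1 - of_real \<alpha> ^ 2) * z * (1 / (1 - of_real \<alpha> * z)))"
    by (simp add: d_def power_mult_distrib mult_ac)
  then have "(\<lambda>j. of_real (d j) * z ^ j)
      sums (- (1 - of_real \<alpha> ^ 2) * z * (1 / (1 - of_real \<alpha> * z)) + of_real \<alpha>)"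
    by (subst (asm) sums_Suc_iff) (simp add: d_def)
  also have "- (1 - of_real \<alpha> ^ 2) * z * (1 / (1 - of_real \<alpha> * z)) + of_real \<alpha> = - \<psi> z"
    using ne by (simp add: \<psi>_def Moebius_function_simple field_simps power2_eq_square)
  finally have "(\<lambda>j. z ^ m * (of_real (d j) * z ^ j)) sums (z ^ m * - \<psi> z)"
    by (rule sums_mult)
  then show "(\<lambda>j. of_real (d j) * z ^ (m + j)) sums (- (z ^ m * \<psi> z))"
    by (simp add: power_add mult_ac)
qed

text \<open>With \<open>r = norm x\<close>, the later terms carry \<open>\<alpha> ^ i * r ^ (i + 1)
  = (\<alpha> * r) ^ (i + 1) / \<alpha>\<close>; hence the tail at \<open>\<alpha> * r\<close> and
  the divisor \<open>\<alpha>\<close>.\<close>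

lemma bohr_sum_Blaschke:
  fixes \<alpha> :: real and m :: nat
  assumes s: "real m + \<gamma> > 0" and \<alpha>: "0 < \<alpha>" "\<alpha> < 1" and x: "norm x < 1"
  defines "d \<equiv> \<lambda>j. case j of 0 \<Rightarrow> \<alpha> | Suc i \<Rightarrow> - (1 - \<alpha>\<^sup>2) * \<alpha> ^ i"
  shows "bohr_term m \<gamma> (\<lambda>k. d (k - m) *\<^sub>R 1) x sums
    (norm x ^ m * ((1 - \<alpha>\<^sup>2) / \<alpha> * bohr_tail (real m + \<gamma>) (\<alpha> * norm x) + \<alpha> / (real m + \<gamma>)))"
    (is "?t sums _")
proof -
  define s where "s = real m + \<gamma>"
  define r where "r = norm x"
  have "\<alpha> * r < 1" using mult_strict_mono[of \<alpha> 1 r 1] \<alpha> x by (simp add: r_def)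
  then have ar: "\<bar>\<alpha> * r\<bar> < 1" using \<alpha> by (simp add: r_def)
  have "\<alpha>\<^sup>2 < 1" using \<alpha> by (simp add: power_less_one_iff)
  have "?t (Suc j) = r ^ m * (1 - \<alpha>\<^sup>2) * r * (1 / (s + 1 + real j) * (\<alpha> * r) ^ j)" for j
    using \<alpha> \<open>\<alpha>\<^sup>2 < 1\<close> s
    by (simp add: bohr_term_def d_def norm_oct_mult norm_oct_power r_def s_def power_add abs_mult
        power_mult_distrib add_ac mult_ac)
  moreover have "(\<lambda>j. r ^ m * (1 - \<alpha>\<^sup>2) * r * (1 / (s + 1 + real j) * (\<alpha> * r) ^ j)) sums
      (r ^ m * (1 - \<alpha>\<^sup>2) * r * (\<Sum>j. 1 / (s + 1 + real j) * (\<alpha> * r) ^ j))"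
    using s ar by (intro sums_mult summable_sums summable_bohr_tail) (auto simp: s_def)
  ultimately have "(\<lambda>j. ?t (Suc j)) sums (r ^ m * ((1 - \<alpha>\<^sup>2) / \<alpha> * bohr_tail s (\<alpha> * r)))"
    using \<alpha> by (simp add: bohr_tail_def mult_ac)
  then have "?t sums (r ^ m * ((1 - \<alpha>\<^sup>2) / \<alpha> * bohr_tail s (\<alpha> * r)) + ?t 0)"
    by (subst (asm) sums_Suc_iff) simp
  then show ?thesis
    using \<alpha> by (simp add: bohr_term_def d_def norm_oct_mult norm_oct_power r_def s_def
        distrib_left mult_ac)
qed

section \<open>Failure of the inequality beyond the radius\<close>

lemma ex_bohr_tail_near_1:
  assumes s: "s > 0" and r: "0 < r" "r < 1" and tail: "bohr_tail s r > 1 / (2 * s)"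
  shows "\<exists>\<alpha>. 0 < \<alpha> \<and> \<alpha> < 1 \<and> (1 + \<alpha>) * bohr_tail s (\<alpha> * r) > 1 / s"
proof -
  have "isCont (bohr_tail s) (1 * r)" using isCont_bohr_tail[OF s] r by simp
  then have "((\<lambda>\<alpha>. (1 + \<alpha>) * bohr_tail s (\<alpha> * r)) \<longlongrightarrow> (1 + 1) * bohr_tail s (1 * r)) (at_left 1)"
    by (intro tendsto_intros isCont_tendsto_compose[of _ "bohr_tail s"])
  \<comment> \<open>The strict inequality holds in the limit \<open>\<alpha> = 1\<close>, hence also
    for \<open>\<alpha>\<close> slightly below 1.\<close>
  moreover have "1 / s < (1 + 1) * bohr_tail s (1 * r)"
    using tail s by (simp add: field_simps)
  ultimately have "eventually (\<lambda>\<alpha>. (1 + \<alpha>) * bohr_tail s (\<alpha> * r) > 1 / s) (at_left 1)"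
    by (rule order_tendstoD)
  moreover have "eventually (\<lambda>y::real. 0 < y \<and> y < 1) (at_left 1)"
    using eventually_at_left[of 0 "1::real"] by (auto intro!: exI[of _ 0])
  ultimately have "eventually (\<lambda>\<alpha>. 0 < \<alpha> \<and> \<alpha> < 1 \<and> (1 + \<alpha>) * bohr_tail s (\<alpha> * r) > 1 / s) (at_left 1)"
    by eventually_elim auto
  then show ?thesis
    using eventually_happens'[OF trivial_limit_at_left_real] by blast
qed

lemma ex_bohr_sum_gt:
  assumes s: "real m + \<gamma> > 0" and r: "0 < r" "r < 1"
    and tail: "bohr_tail (real m + \<gamma>) r > 1 / (2 * (real m + \<gamma>))"
  shows "\<exists>f a. f \<in> SRB \<and> power_series_from m a f \<and>
    (\<forall>x. norm x = r \<longrightarrow> summable (bohr_term m \<gamma> a x) \<and>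
      (\<Sum>j. bohr_term m \<gamma> a x j) > 1 / (real m + \<gamma>) * norm x ^ m)"
proof -
  define s where "s = real m + \<gamma>"
  obtain \<alpha> where \<alpha>: "0 < \<alpha>" "\<alpha> < 1" and gt: "(1 + \<alpha>) * bohr_tail s (\<alpha> * r) > 1 / s"
    using ex_bohr_tail_near_1[OF s r tail] by (auto simp: s_def)
  define a where "a k = (case k - m of 0 \<Rightarrow> \<alpha> | Suc i \<Rightarrow> - (1 - \<alpha>\<^sup>2) * \<alpha> ^ i) *\<^sub>R (1 :: oct)" for k
  have s0: "s > 0" using s by (simp add: s_def)
  \<comment> \<open>Up to the factor \<open>r ^ m\<close>, the sum exceeds \<open>1 / s\<close> by
    \<open>(1 - \<alpha>) / \<alpha> * ((1 + \<alpha>) * bohr_tail s (\<alpha> * r) - \<alpha> /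
    s)\<close>, which is positive for the chosen \<open>\<alpha>\<close>.\<close>
  have "1 / s \<ge> \<alpha> / s" using \<alpha> s0 by (simp add: divide_right_mono)
  then have "(1 - \<alpha>) / \<alpha> * ((1 + \<alpha>) * bohr_tail s (\<alpha> * r)) > (1 - \<alpha>) / \<alpha> * (\<alpha> / s)"
    using \<alpha> gt by (intro mult_strict_left_mono) auto
  moreover have "(1 - \<alpha>) / \<alpha> * ((1 + \<alpha>) * bohr_tail s (\<alpha> * r))
      = (1 - \<alpha>\<^sup>2) / \<alpha> * bohr_tail s (\<alpha> * r)"
    using \<alpha> by (simp add: field_simps power2_eq_square)
  moreover have "(1 - \<alpha>) / \<alpha> * (\<alpha> / s) = 1 / s - \<alpha> / s"
    using \<alpha> s0 by (simp add: field_simps)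
  ultimately have "(1 - \<alpha>\<^sup>2) / \<alpha> * bohr_tail s (\<alpha> * r) + \<alpha> / s > 1 / s"
    by linarith
  then have gt': "r ^ m * ((1 - \<alpha>\<^sup>2) / \<alpha> * bohr_tail s (\<alpha> * r) + \<alpha> / s) > r ^ m * (1 / s)"
    using r by (intro mult_strict_left_mono) auto
  have sums: "bohr_term m \<gamma> a x sums (r ^ m * ((1 - \<alpha>\<^sup>2) / \<alpha> * bohr_tail s (\<alpha> * r) + \<alpha> / s))"
    if "norm x = r" for x
    using bohr_sum_Blaschke[OF s \<alpha>, of x] that r by (simp add: a_def[abs_def] s_def)
  have "summable (bohr_term m \<gamma> a x) \<and>
      (\<Sum>j. bohr_term m \<gamma> a x j) > 1 / (real m + \<gamma>) * norm x ^ m" if "norm x = r" for x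
    using sums[OF that] gt' that by (simp add: sums_iff s_def)
  moreover obtain f where "f \<in> SRB" "power_series_from m a f"
    using ex_SRB_Blaschke[OF \<alpha>, of m] by (auto simp: a_def[abs_def])
  ultimately show ?thesis by blast
qed

theorem theorem2p2:
  fixes m :: nat and \<gamma> :: real
  assumes "\<gamma> > - real m"
  shows "(\<exists>!R. is_bohr_radius m \<gamma> R) \<and>
    (\<forall>R. is_bohr_radius m \<gamma> R \<longrightarrow>
      (\<forall>f a x. f \<in> SRB \<and> power_series_from m a f \<and> x \<in> ball 0 1 \<and> norm x \<le> R \<longrightarrow>
         summable (bohr_term m \<gamma> a x) \<and>
         (\<Sum>j. bohr_term m \<gamma> a x j) \<le> 1 / (real m + \<gamma>) * norm x ^ m) \<and>
      (\<forall>r\<in>{R<..<1}. \<exists>f a. f \<in> SRB \<and> power_series_from m a f \<and>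
         (\<forall>x. norm x = r \<longrightarrow>
            summable (bohr_term m \<gamma> a x) \<and>
            (\<Sum>j. bohr_term m \<gamma> a x j) > 1 / (real m + \<gamma>) * norm x ^ m)))"
proof -
  have s: "real m + \<gamma> > 0" using assms by simp
  \<comment> \<open>The non-strict form covers the boundary case \<open>norm x = R\<close>.\<close>
  have mono: "bohr_tail (real m + \<gamma>) y1 \<le> bohr_tail (real m + \<gamma>) y2"
    if "0 \<le> y1" "y1 \<le> y2" "y2 < 1" for y1 y2
    using bohr_tail_strict_mono[OF s, of y1 y2] that by (cases "y1 = y2") auto
  show ?thesis
  proof (intro conjI allI impI ballI)
    show "\<exists>!R. is_bohr_radius m \<gamma> R"
      unfolding is_bohr_radius_iff[OF s] using s by (intro bohr_tail_ex1) auto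
  next
    fix R and f :: "oct \<Rightarrow> oct" and a and x :: oct
    assume R: "is_bohr_radius m \<gamma> R"
      and fx: "f \<in> SRB \<and> power_series_from m a f \<and> x \<in> ball 0 1 \<and> norm x \<le> R"
    have coeff: "norm (a (m + j)) \<le> 1 - (norm (a m))\<^sup>2" if "j > 0" for j
      using fx that by (intro power_series_coeff_bound[of m a f]) (auto simp: SRB_def)
    \<comment> \<open>The right-hand side is the value of the tail at \<open>R\<close>.\<close>
    have "bohr_tail (real m + \<gamma>) (norm x) \<le> 1 / (2 * (real m + \<gamma>))"
      using R fx mono[of "norm x" R] by (simp add: is_bohr_radius_iff[OF s])
    then have *: "summable (bohr_term m \<gamma> a x) \<and>
        (\<Sum>j. bohr_term m \<gamma> a x j) \<le> 1 / (real m + \<gamma>) * norm x ^ m"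
      using fx coeff by (intro bohr_sum_le s) auto
    show "summable (bohr_term m \<gamma> a x)"
      and "(\<Sum>j. bohr_term m \<gamma> a x j) \<le> 1 / (real m + \<gamma>) * norm x ^ m"
      using * by simp_all
  next
    fix R r assume R: "is_bohr_radius m \<gamma> R" and r: "r \<in> {R<..<1}"
    have "bohr_tail (real m + \<gamma>) r > 1 / (2 * (real m + \<gamma>))"
      using R r bohr_tail_strict_mono[OF s, of R r] by (simp add: is_bohr_radius_iff[OF s])
    then show "\<exists>f a. f \<in> SRB \<and> power_series_from m a f \<and>
        (\<forall>x. norm x = r \<longrightarrow> summable (bohr_term m \<gamma> a x) \<and>
          (\<Sum>j. bohr_term m \<gamma> a x j) > 1 / (real m + \<gamma>) * norm x ^ m)"
      using R r by (intro ex_bohr_sum_gt s) (auto simp: is_bohr_radius_def)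
  qed
qed

end
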